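(* Let $W$ be a finite Coxeter group and $M(W)$ its biHecke monoid. The elements $f$ of $M(W)$ preserve Bruhat order: for all $u,v\in W$, $u\le_B v$ implies $u.f\le_B v.f$.
   Context: $W$ is a finite Coxeter group with simple reflections $(s_i)_{i\in I}$ and length $\ell$; $D_R(w)=\{i:\ell(ws_i)<\ell(w)\}$. The biHecke monoid $M(W)$ is the monoid of functions $W\to W$, acting on the right, generated by $\pi_i,\overline\pi_i$ ($i\in I$), where $w.\pi_i=w$ if $i\in D_R(w)$ and $ws_i$ otherwise; $w.\overline\pi_i=ws_i$ if $i\in D_R(w)$ and $w$ otherwise. Bruhat order: $u\le_B v$ if some reduced word of $u$ is a subword of some reduced word of $v$. *)

theory Defs
  imports "HOL-Algebra.Group" "HOL-Library.Sublist"
begin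

section \<open>Group presentations\<close>

text \<open>
  A word in the free group on \<open>I\<close> is a list of signed letters: \<open>(True, i)\<close> stands for the
  generator \<open>i\<close> and \<open>(False, i)\<close> for its formal inverse.
\<close>

type_synonym 'i gword = "(bool \<times> 'i) list"

abbreviation gwords :: "'i set \<Rightarrow> 'i gword set" where
  "gwords I \<equiv> lists (UNIV \<times> I)"

definition gword_eval :: "('a, 'b) monoid_scheme \<Rightarrow> ('i \<Rightarrow> 'a) \<Rightarrow> 'i gword \<Rightarrow> 'a" where
  "gword_eval G s w =
    foldr (\<otimes>\<^bsub>G\<^esub>) (map (\<lambda>(e, i). if e then s i else inv\<^bsub>G\<^esub> (s i)) w) \<one>\<^bsub>G\<^esub>"

text \<open>Equality of words in the group with generators \<open>I\<close> and relators \<open>R\<close>.\<close>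

inductive gword_equiv :: "'i set \<Rightarrow> 'i gword set \<Rightarrow> 'i gword \<Rightarrow> 'i gword \<Rightarrow> bool"
  for I :: "'i set" and R :: "'i gword set" where
  cancel: "\<lbrakk>u \<in> gwords I; v \<in> gwords I; i \<in> I\<rbrakk>
    \<Longrightarrow> gword_equiv I R (u @ [(e, i), (\<not> e, i)] @ v) (u @ v)"
| relator: "\<lbrakk>u \<in> gwords I; v \<in> gwords I; r \<in> R\<rbrakk> \<Longrightarrow> gword_equiv I R (u @ r @ v) (u @ v)"
| refl: "u \<in> gwords I \<Longrightarrow> gword_equiv I R u u"
| sym: "gword_equiv I R u v \<Longrightarrow> gword_equiv I R v u"
| trans: "\<lbrakk>gword_equiv I R u v; gword_equiv I R v w\<rbrakk> \<Longrightarrow> gword_equiv I R u w"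

definition presents :: "('a, 'b) monoid_scheme \<Rightarrow> 'i set \<Rightarrow> ('i \<Rightarrow> 'a) \<Rightarrow> 'i gword set \<Rightarrow> bool" where
  "presents G I s R \<longleftrightarrow>
    s \<in> I \<rightarrow> carrier G \<and>
    gword_eval G s ` gwords I = carrier G \<and>
    (\<forall>u \<in> gwords I. \<forall>v \<in> gwords I. gword_eval G s u = gword_eval G s v \<longleftrightarrow> gword_equiv I R u v)"

section \<open>Coxeter groups\<close>

text \<open>
  The value \<open>m i j = 0\<close> encodes the customary \<open>m(i,j) = \<infinity>\<close>: the relator \<open>(s\<^sub>i s\<^sub>j)\<^sup>0\<close> is the empty
  word and imposes nothing.
\<close>

definition coxeter_matrix :: "'i set \<Rightarrow> ('i \<Rightarrow> 'i \<Rightarrow> nat) \<Rightarrow> bool" where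
  "coxeter_matrix I m \<longleftrightarrow>
    (\<forall>i \<in> I. m i i = 1) \<and>
    (\<forall>i \<in> I. \<forall>j \<in> I. m i j = m j i \<and> (i \<noteq> j \<longrightarrow> m i j \<noteq> 1))"

definition coxeter_relators :: "'i set \<Rightarrow> ('i \<Rightarrow> 'i \<Rightarrow> nat) \<Rightarrow> 'i gword set" where
  "coxeter_relators I m =
    {concat (replicate (m i j) [(True, i), (True, j)]) | i j. i \<in> I \<and> j \<in> I}"

definition coxeter_group ::
  "('a, 'b) monoid_scheme \<Rightarrow> 'i set \<Rightarrow> ('i \<Rightarrow> 'a) \<Rightarrow> ('i \<Rightarrow> 'i \<Rightarrow> nat) \<Rightarrow> bool" where
  "coxeter_group G I s m \<longleftrightarrow>
    group G \<and> coxeter_matrix I m \<and> presents G I s (coxeter_relators I m)"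

definition word_prod :: "('a, 'b) monoid_scheme \<Rightarrow> ('i \<Rightarrow> 'a) \<Rightarrow> 'i list \<Rightarrow> 'a" where
  "word_prod G s xs = foldr (\<otimes>\<^bsub>G\<^esub>) (map s xs) \<one>\<^bsub>G\<^esub>"

definition cox_length :: "('a, 'b) monoid_scheme \<Rightarrow> 'i set \<Rightarrow> ('i \<Rightarrow> 'a) \<Rightarrow> 'a \<Rightarrow> nat" where
  "cox_length G I s w = (LEAST n. \<exists>xs \<in> lists I. word_prod G s xs = w \<and> length xs = n)"

definition reduced_word ::
  "('a, 'b) monoid_scheme \<Rightarrow> 'i set \<Rightarrow> ('i \<Rightarrow> 'a) \<Rightarrow> 'a \<Rightarrow> 'i list \<Rightarrow> bool" where
  "reduced_word G I s w xs \<longleftrightarrow>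
    xs \<in> lists I \<and> word_prod G s xs = w \<and> length xs = cox_length G I s w"

definition right_descents :: "('a, 'b) monoid_scheme \<Rightarrow> 'i set \<Rightarrow> ('i \<Rightarrow> 'a) \<Rightarrow> 'a \<Rightarrow> 'i set" where
  "right_descents G I s w = {i \<in> I. cox_length G I s (w \<otimes>\<^bsub>G\<^esub> s i) < cox_length G I s w}"

text \<open>Subwords need not be contiguous.\<close>

definition bruhat_le ::
  "('a, 'b) monoid_scheme \<Rightarrow> 'i set \<Rightarrow> ('i \<Rightarrow> 'a) \<Rightarrow> 'a \<Rightarrow> 'a \<Rightarrow> bool" where
  "bruhat_le G I s u v \<longleftrightarrow>
    (\<exists>xs ys. reduced_word G I s u xs \<and> reduced_word G I s v ys \<and> subseq xs ys)"

section \<open>The biHecke monoid\<close>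

text \<open>
  Functions act on the right, so the product \<open>f g\<close> applies \<open>f\<close> first. Functions \<open>X \<rightarrow> X\<close> are
  represented extensionally, i.e. with value \<open>undefined\<close> outside \<open>X\<close>.
\<close>

definition transformation_monoid :: "'a set \<Rightarrow> ('a \<Rightarrow> 'a) monoid" where
  "transformation_monoid X =
    \<lparr>carrier = X \<rightarrow>\<^sub>E X, mult = (\<lambda>f g. compose X g f), one = restrict id X\<rparr>"

inductive_set submonoid_gen :: "('a, 'b) monoid_scheme \<Rightarrow> 'a set \<Rightarrow> 'a set"
  for T :: "('a, 'b) monoid_scheme" and A :: "'a set" where
  one: "\<one>\<^bsub>T\<^esub> \<in> submonoid_gen T A"
| incl: "a \<in> A \<Longrightarrow> a \<in> submonoid_gen T A"
| mult: "\<lbrakk>a \<in> submonoid_gen T A; b \<in> submonoid_gen T A\<rbrakk> \<Longrightarrow> a \<otimes>\<^bsub>T\<^esub> b \<in> submonoid_gen T A"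

definition hecke_pi ::
  "('a, 'b) monoid_scheme \<Rightarrow> 'i set \<Rightarrow> ('i \<Rightarrow> 'a) \<Rightarrow> 'i \<Rightarrow> 'a \<Rightarrow> 'a" where
  "hecke_pi G I s i =
    (\<lambda>w \<in> carrier G. if i \<in> right_descents G I s w then w else w \<otimes>\<^bsub>G\<^esub> s i)"

definition hecke_pibar ::
  "('a, 'b) monoid_scheme \<Rightarrow> 'i set \<Rightarrow> ('i \<Rightarrow> 'a) \<Rightarrow> 'i \<Rightarrow> 'a \<Rightarrow> 'a" where
  "hecke_pibar G I s i =
    (\<lambda>w \<in> carrier G. if i \<in> right_descents G I s w then w \<otimes>\<^bsub>G\<^esub> s i else w)"

definition biHecke_monoid ::
  "('a, 'b) monoid_scheme \<Rightarrow> 'i set \<Rightarrow> ('i \<Rightarrow> 'a) \<Rightarrow> ('a \<Rightarrow> 'a) monoid" where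
  "biHecke_monoid G I s =
    (transformation_monoid (carrier G))
      \<lparr>carrier := submonoid_gen (transformation_monoid (carrier G))
                   (hecke_pi G I s ` I \<union> hecke_pibar G I s ` I)\<rparr>"

end

theory Submission
  imports Defs
begin

text \<open>
  Monotonicity is awkward to see from subwords but easy to see from reflections. Write
  \<open>u \<rightarrow> v\<close> if \<open>v = t u\<close> for a reflection \<open>t\<close> and \<open>v\<close> is longer than \<open>u\<close>. Bruhat order is the
  reflexive transitive closure of \<open>\<rightarrow>\<close> (\<open>bruhat_le_iff_chain_le\<close>), so it is enough to follow a
  single step \<open>u \<rightarrow> v = t u\<close> through one generator of the biHecke monoid
  (\<open>bruhat_step_up_down\<close>). Since reflections act on the left and generators on the right,
  \<open>v s\<^sub>i = t (u s\<^sub>i)\<close> with the \<^emph>\<open>same\<close> reflection \<open>t\<close>, and only the comparison of the lengths of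
  \<open>u s\<^sub>i\<close> and \<open>v s\<^sub>i\<close> remains. The only configuration in which these lengths are not controlled by
  counting is that \<open>s\<^sub>i\<close> lengthens \<open>u\<close> and shortens \<open>v\<close>; there the exchange property shows that
  either \<open>v = u s\<^sub>i\<close>, when both images coincide, or \<open>u \<rightarrow> u s\<^sub>i \<rightarrow> v s\<^sub>i \<rightarrow> v\<close>.

  Two ingredients carry this. The first is the strong exchange property (\<open>strong_exchange\<close>): if a
  reflection \<open>t\<close> shortens an element, then multiplying a word of it by \<open>t\<close> deletes one of the
  letters. It rests on the fact that the parity of the number of times a word crosses the wall of
  \<open>t\<close> depends only on the element represented (\<open>crossings_parity\<close>), which is checked on the defining
  relations. The second is the comparison of chains with subwords. From chains to subwords, each
  step downwards deletes a letter, and the resulting subword is then thinned to a reduced one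
  (\<open>chain_le_subword\<close>, \<open>reduced_subword\<close>). From subwords to chains, one inducts on the length of the
  word (\<open>subword_chain_le\<close>); when both words end in the same letter, the induction step is itself
  the monotonicity of \<open>\<pi>\<^sub>i\<close> for the chain order.
\<close>

lemma subseq_delete: "subseq (as @ bs) (as @ x # bs)"
  by (simp add: list_emb_append_mono subseq_Cons')

lemma sum_lessThan_add:
  fixes f :: "nat \<Rightarrow> 'b::comm_monoid_add"
  shows "(\<Sum>n<k + l. f n) = (\<Sum>n<k. f n) + (\<Sum>n<l. f (k + n))"
  by (induction l) (simp_all add: add.assoc)

locale coxeter = group W for W (structure) +
  fixes I :: "'i set" and s :: "'i \<Rightarrow> 'a" and m :: "'i \<Rightarrow> 'i \<Rightarrow> nat"
  assumes coxeter: "coxeter_group W I s m"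
begin

abbreviation wprod :: "'i list \<Rightarrow> 'a" where "wprod \<equiv> word_prod W s"
abbreviation len :: "'a \<Rightarrow> nat" where "len \<equiv> cox_length W I s"
abbreviation le :: "'a \<Rightarrow> 'a \<Rightarrow> bool" where "le \<equiv> bruhat_le W I s"

declare in_lists_conv_set [simp]

section \<open>Words and length\<close>

lemma presents: "presents W I s (coxeter_relators I m)"
  using coxeter by (simp add: coxeter_group_def)

lemma s_closed [simp]: "i \<in> I \<Longrightarrow> s i \<in> carrier W"
  using presents by (auto simp: presents_def)

lemma wprod_Nil [simp]: "wprod [] = \<one>"
  by (simp add: word_prod_def)

lemma wprod_Cons [simp]: "wprod (x # xs) = s x \<otimes> wprod xs"
  by (simp add: word_prod_def)

lemma wprod_closed [simp]: "xs \<in> lists I \<Longrightarrow> wprod xs \<in> carrier W"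
  by (induction xs) auto

lemma wprod_append [simp]:
  "xs \<in> lists I \<Longrightarrow> ys \<in> lists I \<Longrightarrow> wprod (xs @ ys) = wprod xs \<otimes> wprod ys"
  by (induction xs) (auto simp: m_assoc)

lemma gword_eval_positive: "xs \<in> lists I \<Longrightarrow> gword_eval W s (map (Pair True) xs) = wprod xs"
  by (induction xs) (auto simp: gword_eval_def word_prod_def)

lemma map_Pair_in_gwords: "xs \<in> lists I \<Longrightarrow> map (Pair True) xs \<in> gwords I"
  by (induction xs) auto

lemma map_snd_in_lists: "u \<in> gwords I \<Longrightarrow> map snd u \<in> lists I"
  by (induction u) auto

lemma relator_word:
  "concat (replicate k [(True, i), (True, j)]) = map (Pair True) (concat (replicate k [i, j]))"
  by (induction k) auto

lemma alternating_word_in_lists: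
  "i \<in> I \<Longrightarrow> j \<in> I \<Longrightarrow> concat (replicate k [i, j]) \<in> lists I"
  by (induction k) auto

lemma wprod_relator:
  assumes "i \<in> I" "j \<in> I"
  shows "wprod (concat (replicate (m i j) [i, j])) = \<one>"
proof -
  let ?r = "concat (replicate (m i j) [(True, i), (True, j)])"
  have r: "?r \<in> coxeter_relators I m"
    using assms by (auto simp: coxeter_relators_def)
  have "?r \<in> gwords I"
    unfolding relator_word by (rule map_Pair_in_gwords[OF alternating_word_in_lists[OF assms]])
  moreover have "gword_equiv I (coxeter_relators I m) ?r []"
    using gword_equiv.relator[of "[]" I "[]", OF _ _ r] by simp
  ultimately have "gword_eval W s ?r = gword_eval W s []"
    using presents by (auto simp: presents_def)
  then have "wprod (concat (replicate (m i j) [i, j])) = gword_eval W s []"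
    using gword_eval_positive[OF alternating_word_in_lists[OF assms]] by (simp add: relator_word)
  then show ?thesis by (simp add: gword_eval_def)
qed

lemma s_involution [simp]:
  assumes "i \<in> I" shows "s i \<otimes> s i = \<one>"
proof -
  have "m i i = 1"
    using coxeter assms by (auto simp: coxeter_group_def coxeter_matrix_def)
  then show ?thesis using wprod_relator[OF assms assms] assms by simp
qed

lemma s_inv [simp]: "i \<in> I \<Longrightarrow> inv (s i) = s i"
  by (simp add: inv_equality)

lemma s_cancel_left [simp]: "i \<in> I \<Longrightarrow> w \<in> carrier W \<Longrightarrow> s i \<otimes> (s i \<otimes> w) = w"
  by (simp flip: m_assoc)

lemma s_cancel_right [simp]: "i \<in> I \<Longrightarrow> w \<in> carrier W \<Longrightarrow> w \<otimes> s i \<otimes> s i = w"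
  by (simp add: m_assoc)

lemma inv_mult_cancel [simp]:
  "x \<in> carrier W \<Longrightarrow> y \<in> carrier W \<Longrightarrow> inv x \<otimes> (x \<otimes> y) = y"
  "x \<in> carrier W \<Longrightarrow> y \<in> carrier W \<Longrightarrow> x \<otimes> (inv x \<otimes> y) = y"
  by (simp_all flip: m_assoc)

lemma gword_eval_eq_wprod: "u \<in> gwords I \<Longrightarrow> gword_eval W s u = wprod (map snd u)"
  by (induction u) (auto simp: gword_eval_def word_prod_def)

lemma ex_word: "w \<in> carrier W \<Longrightarrow> \<exists>xs\<in>lists I. wprod xs = w"
proof -
  assume "w \<in> carrier W"
  then have "w \<in> gword_eval W s ` gwords I"
    using presents by (simp add: presents_def)
  then obtain u where "u \<in> gwords I" "gword_eval W s u = w" by blast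
  then show ?thesis
    using map_snd_in_lists gword_eval_eq_wprod by (intro bexI[of _ "map snd u"]) simp_all
qed

lemma len_le: "xs \<in> lists I \<Longrightarrow> len (wprod xs) \<le> length xs"
  unfolding cox_length_def by (rule Least_le) blast

lemma reduced_word_exists: "w \<in> carrier W \<Longrightarrow> \<exists>xs. reduced_word W I s w xs"
proof -
  assume "w \<in> carrier W"
  then have "\<exists>n. \<exists>xs\<in>lists I. wprod xs = w \<and> length xs = n"
    using ex_word by blast
  from LeastI_ex[OF this] show ?thesis
    unfolding reduced_word_def cox_length_def by blast
qed

lemma wprod_rev: "xs \<in> lists I \<Longrightarrow> wprod (rev xs) = inv (wprod xs)"
  by (induction xs) (auto simp: inv_mult_group)

lemma len_mult_right_le: "w \<in> carrier W \<Longrightarrow> i \<in> I \<Longrightarrow> len (w \<otimes> s i) \<le> Suc (len w)"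
proof -
  assume *: "w \<in> carrier W" "i \<in> I"
  then obtain xs where "xs \<in> lists I" "wprod xs = w" "length xs = len w"
    using reduced_word_exists by (auto simp: reduced_word_def)
  then show ?thesis using len_le[of "xs @ [i]"] * by auto
qed

lemma len_mult_left_le: "w \<in> carrier W \<Longrightarrow> i \<in> I \<Longrightarrow> len (s i \<otimes> w) \<le> Suc (len w)"
proof -
  assume *: "w \<in> carrier W" "i \<in> I"
  then obtain xs where "xs \<in> lists I" "wprod xs = w" "length xs = len w"
    using reduced_word_exists by (auto simp: reduced_word_def)
  then show ?thesis using len_le[of "i # xs"] * by auto
qed

section \<open>The strong exchange property\<close>

text \<open>
  For a word \<open>x\<^sub>1 \<dots> x\<^sub>k\<close> this counts the positions \<open>j\<close> with
  \<open>t = x\<^sub>1 \<dots> x\<^sub>j\<^sub>-\<^sub>1 x\<^sub>j x\<^sub>j\<^sub>-\<^sub>1 \<dots> x\<^sub>1\<close>. In the Coxeter complex the prefixes of the word form a gallery, and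
  these are the steps at which the gallery crosses the wall of the reflection \<open>t\<close>.
\<close>

fun crossings :: "'i list \<Rightarrow> 'a \<Rightarrow> nat" where
  "crossings [] t = 0"
| "crossings (x # xs) t = of_bool (t = s x) + crossings xs (s x \<otimes> t \<otimes> s x)"

lemma crossings_append:
  "xs \<in> lists I \<Longrightarrow> t \<in> carrier W \<Longrightarrow>
    crossings (xs @ ys) t = crossings xs t + crossings ys (inv (wprod xs) \<otimes> t \<otimes> wprod xs)"
  by (induction xs arbitrary: t) (auto simp: inv_mult_group m_assoc)

lemma conj_eq_iff:
  assumes "a \<in> carrier W" "t \<in> carrier W" "b \<in> carrier W"
  shows "inv a \<otimes> t \<otimes> a = b \<longleftrightarrow> t = a \<otimes> b \<otimes> inv a"
proof
  assume "inv a \<otimes> t \<otimes> a = b"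
  then have "a \<otimes> b \<otimes> inv a = a \<otimes> (inv a \<otimes> t \<otimes> a) \<otimes> inv a" by simp
  also have "\<dots> = t" using assms by (simp add: m_assoc)
  finally show "t = a \<otimes> b \<otimes> inv a" by simp
next
  assume "t = a \<otimes> b \<otimes> inv a"
  then show "inv a \<otimes> t \<otimes> a = b" using assms by (simp add: m_assoc)
qed

text \<open>
  Put \<open>r = s\<^sub>i s\<^sub>j\<close>. As \<open>s\<^sub>i r\<^sup>-\<^sup>1 = r s\<^sub>i\<close>, the \<open>n\<close>-th wall crossed by the word \<open>i j i j \<dots>\<close> belongs to
  \<open>r\<^sup>n s\<^sub>i\<close>. This explicit list makes the periodicity in \<open>n\<close> visible.
\<close>

lemma crossings_alternating:
  assumes "i \<in> I" "j \<in> I" "t \<in> carrier W"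
  shows "crossings (concat (replicate k [i, j])) t
    = (\<Sum>n<2 * k. of_bool (t = (s i \<otimes> s j) [^] n \<otimes> s i))"
  using assms(3)
proof (induction k arbitrary: t)
  case 0
  then show ?case by simp
next
  case (Suc k)
  define r where "r = s i \<otimes> s j"
  have r: "r \<in> carrier W" "inv r = s j \<otimes> s i"
    using assms(1,2) by (simp_all add: r_def inv_mult_group)
  have rs: "s i \<otimes> inv r = r \<otimes> s i"
    using assms by (simp add: r_def inv_mult_group m_assoc)
  \<comment> \<open>The first two letters conjugate by \<open>r\<close>, which moves every later wall by two places.\<close>
  have step: "s j \<otimes> (s i \<otimes> t \<otimes> s i) \<otimes> s j = r [^] n \<otimes> s i
      \<longleftrightarrow> t = r [^] Suc (Suc n) \<otimes> s i" for n :: nat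
  proof -
    have "s j \<otimes> (s i \<otimes> t \<otimes> s i) \<otimes> s j = inv r \<otimes> t \<otimes> r"
      using assms Suc.prems by (simp add: r_def inv_mult_group m_assoc)
    moreover have "r \<otimes> (r [^] n \<otimes> s i) \<otimes> inv r = r [^] Suc (Suc n) \<otimes> s i"
    proof -
      have "r \<otimes> (r [^] n \<otimes> s i) \<otimes> inv r = (r \<otimes> r [^] n) \<otimes> (s i \<otimes> inv r)"
        using assms r by (simp add: m_assoc)
      also have "\<dots> = r [^] Suc n \<otimes> (r \<otimes> s i)"
        using r nat_pow_Suc2 rs by metis
      also have "\<dots> = r [^] Suc (Suc n) \<otimes> s i"
        using assms r by (simp add: m_assoc)
      finally show ?thesis .
    qed
    ultimately show ?thesis
      using conj_eq_iff[of r t "r [^] n \<otimes> s i"] r assms Suc.prems by simp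
  qed
  have first: "s i \<otimes> t \<otimes> s i = s j \<longleftrightarrow> t = r [^] (1::nat) \<otimes> s i"
    using conj_eq_iff[of "s i" t "s j"] assms Suc.prems by (simp add: r_def)
  have "crossings (concat (replicate (Suc k) [i, j])) t
      = of_bool (t = s i) + (of_bool (t = r [^] (1::nat) \<otimes> s i)
        + (\<Sum>n<2 * k. of_bool (t = r [^] Suc (Suc n) \<otimes> s i)))"
    using Suc.IH[of "s j \<otimes> (s i \<otimes> t \<otimes> s i) \<otimes> s j"] assms Suc.prems
    by (simp only: first step r_def[symmetric] replicate_Suc concat.simps append_Cons append_Nil
        crossings.simps m_closed s_closed)
  also have "\<dots> = (\<Sum>n<2 * Suc k. of_bool (t = r [^] n \<otimes> s i))"
    using assms by (simp add: sum.lessThan_Suc_shift del: sum.lessThan_Suc nat_pow_Suc)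
  finally show ?case by (simp only: r_def)
qed

lemma wprod_alternating:
  "i \<in> I \<Longrightarrow> j \<in> I \<Longrightarrow> wprod (concat (replicate k [i, j])) = (s i \<otimes> s j) [^] k"
proof (induction k)
  case (Suc k)
  then show ?case using nat_pow_Suc2[of "s i \<otimes> s j" k]
    by (simp add: m_assoc alternating_word_in_lists del: nat_pow_Suc)
qed simp

text \<open>
  Since \<open>r\<^sup>m = 1\<close> for \<open>m = m i j\<close>, the \<open>2m\<close> walls \<open>r\<^sup>n s\<^sub>i\<close> run twice through the same list, so every wall
  is crossed an even number of times. In the case \<open>m i j = 0\<close> the relator is empty.
\<close>

lemma even_crossings_relator:
  assumes "i \<in> I" "j \<in> I" "t \<in> carrier W"
  shows "even (crossings (concat (replicate (m i j) [i, j])) t)"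
proof -
  let ?r = "s i \<otimes> s j" and ?m = "m i j"
  have "?r [^] ?m = \<one>"
    using wprod_relator wprod_alternating assms by metis
  then have period: "?r [^] (?m + n) = ?r [^] n" for n
    using nat_pow_mult[of ?r ?m n] assms by simp
  have "(\<Sum>n<2 * ?m. of_bool (t = ?r [^] n \<otimes> s i))
      = (\<Sum>n<?m. of_bool (t = ?r [^] n \<otimes> s i))
        + (\<Sum>n<?m. of_bool (t = ?r [^] (?m + n) \<otimes> s i) :: nat)"
    using sum_lessThan_add[of _ ?m ?m] by (simp only: mult_2)
  then show ?thesis using crossings_alternating[OF assms] by (simp add: period)
qed

text \<open>
  A factor representing \<open>\<one>\<close> does not change how the later walls are conjugated, so only its own
  crossings disappear when it is removed. Both kinds of rewriting steps in a presented group have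
  this form.
\<close>

lemma crossings_drop_trivial_factor:
  assumes "us \<in> lists I" "rs \<in> lists I" "wprod rs = \<one>"
    and even: "\<And>t. t \<in> carrier W \<Longrightarrow> even (crossings rs t)"
    and t: "t \<in> carrier W"
  shows "even (crossings (us @ rs @ vs) t) \<longleftrightarrow> even (crossings (us @ vs) t)"
proof -
  let ?t = "inv (wprod us) \<otimes> t \<otimes> wprod us"
  have "?t \<in> carrier W" using assms by simp
  then have "crossings (us @ rs @ vs) t = crossings us t + (crossings rs ?t + crossings vs ?t)"
    using assms by (simp add: crossings_append)
  moreover have "crossings (us @ vs) t = crossings us t + crossings vs ?t"
    using assms by (simp add: crossings_append)
  ultimately show ?thesis using even[OF \<open>?t \<in> carrier W\<close>] by simp
qed

lemma gword_equiv_crossings: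
  assumes "gword_equiv I (coxeter_relators I m) u v" "t \<in> carrier W"
  shows "even (crossings (map snd u) t) \<longleftrightarrow> even (crossings (map snd v) t)"
  using assms(1)
proof induction
  case (cancel u v i e)
  have "s i \<otimes> x \<otimes> s i = s i \<longleftrightarrow> x = s i" if "x \<in> carrier W" for x
    using conj_eq_iff[of "s i" x "s i"] that cancel(3) by simp
  then have "even (crossings [i, i] x)" if "x \<in> carrier W" for x
    using that by simp
  then show ?case
    using crossings_drop_trivial_factor[of "map snd u" "[i, i]" t "map snd v"]
      map_snd_in_lists[OF cancel(1)] cancel(3) assms(2) by simp
next
  case (relator u v r)
  then obtain i j where ij: "i \<in> I" "j \<in> I"
    and r: "r = concat (replicate (m i j) [(True, i), (True, j)])"
    by (auto simp: coxeter_relators_def)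
  have "map snd r = concat (replicate (m i j) [i, j])"
    unfolding r relator_word by (simp add: comp_def)
  then have "map snd r \<in> lists I" "wprod (map snd r) = \<one>"
    "\<And>x. x \<in> carrier W \<Longrightarrow> even (crossings (map snd r) x)"
    using ij alternating_word_in_lists[OF ij] wprod_relator even_crossings_relator by simp_all
  from crossings_drop_trivial_factor[OF map_snd_in_lists[OF relator(1)] this assms(2)]
  show ?case by simp
qed auto

text \<open>
  Words for the same element are connected by cancellations and relators, neither of which
  changes the parity. This is the one place where the presentation of the group is used in full:
  nontrivial coincidences in \<open>W\<close> all come from the Coxeter relations.
\<close>

lemma crossings_parity:
  assumes "xs \<in> lists I" "ys \<in> lists I" "wprod xs = wprod ys" "t \<in> carrier W"
  shows "even (crossings xs t) \<longleftrightarrow> even (crossings ys t)"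
proof -
  have "gword_equiv I (coxeter_relators I m) (map (Pair True) xs) (map (Pair True) ys)"
    using presents assms map_Pair_in_gwords[OF assms(1)] map_Pair_in_gwords[OF assms(2)]
      gword_eval_positive[OF assms(1)] gword_eval_positive[OF assms(2)]
    unfolding presents_def by metis
  from gword_equiv_crossings[OF this assms(4)] show ?thesis
    by (simp add: comp_def)
qed

text \<open>
  If \<open>t = x\<^sub>1 \<dots> x\<^sub>j \<dots> x\<^sub>1\<close>, then left multiplication by \<open>t\<close> cancels the first \<open>j\<close> letters and writes the
  first \<open>j - 1\<close> of them back.
\<close>

lemma crossing_deletes_letter:
  assumes "xs \<in> lists I" "t \<in> carrier W" "crossings xs t \<noteq> 0"
  shows "\<exists>as x bs. xs = as @ x # bs \<and> t \<otimes> wprod xs = wprod (as @ bs)"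
  using assms
proof (induction xs arbitrary: t rule: list.induct)
  case (Cons x xs)
  have x: "x \<in> I" "xs \<in> lists I" using Cons.prems(1) by auto
  show ?case
  proof (cases "t = s x")
    case True
    then have "x # xs = [] @ x # xs \<and> t \<otimes> wprod (x # xs) = wprod ([] @ xs)"
      using x by simp
    then show ?thesis by blast
  next
    case False
    then obtain as y bs where *: "xs = as @ y # bs"
      "(s x \<otimes> t \<otimes> s x) \<otimes> wprod xs = wprod (as @ bs)"
      using Cons.IH[of "s x \<otimes> t \<otimes> s x"] Cons.prems x by auto
    have "t \<otimes> wprod (x # xs) = s x \<otimes> ((s x \<otimes> t \<otimes> s x) \<otimes> wprod xs)"
      using x Cons.prems(2) by (simp add: m_assoc)
    also have "\<dots> = wprod ((x # as) @ bs)"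
      by (simp add: *(2))
    finally have "x # xs = (x # as) @ y # bs \<and> t \<otimes> wprod (x # xs) = wprod ((x # as) @ bs)"
      using *(1) by simp
    then show ?thesis by blast
  qed
qed simp

definition reflections :: "'a set" where
  "reflections = {w \<otimes> s i \<otimes> inv w | w i. w \<in> carrier W \<and> i \<in> I}"

lemma conj_reflection:
  assumes "w \<in> carrier W" "i \<in> I" shows "w \<otimes> s i \<otimes> inv w \<in> reflections"
  unfolding reflections_def using assms by blast

lemma s_reflection: "i \<in> I \<Longrightarrow> s i \<in> reflections"
  using conj_reflection[of \<one> i] by simp

lemma reflection_closed [simp]: "t \<in> reflections \<Longrightarrow> t \<in> carrier W"
  by (auto simp: reflections_def)

lemma reflection_involution: "t \<in> reflections \<Longrightarrow> t \<otimes> t = \<one>"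
proof -
  assume "t \<in> reflections"
  then obtain w i where "w \<in> carrier W" "i \<in> I" "t = w \<otimes> s i \<otimes> inv w"
    unfolding reflections_def by blast
  then show ?thesis by (simp add: m_assoc)
qed

lemma reflection_cancel: "t \<in> reflections \<Longrightarrow> w \<in> carrier W \<Longrightarrow> t \<otimes> (t \<otimes> w) = w"
  using reflection_involution by (simp flip: m_assoc)

text \<open>
  The palindrome \<open>us i us\<^sup>-\<^sup>1\<close> for \<open>t\<close> crosses the wall of \<open>t\<close> with its middle letter. Its two outer
  parts contribute evenly together, because \<open>us us\<^sup>-\<^sup>1\<close> represents \<open>\<one>\<close> and the middle letter sends
  the wall of \<open>t\<close>, seen after \<open>us\<close>, to itself.
\<close>

lemma reflection_self_crossing:
  assumes "t \<in> reflections"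
  obtains ts where "ts \<in> lists I" "wprod ts = t" "odd (crossings ts t)"
proof -
  from assms obtain w i where wi: "w \<in> carrier W" "i \<in> I" "t = w \<otimes> s i \<otimes> inv w"
    unfolding reflections_def by blast
  from ex_word[OF wi(1)] obtain us where us: "us \<in> lists I" "wprod us = w"
    by auto
  let ?ts = "us @ [i] @ rev us"
  have t: "t \<in> carrier W" using assms by simp
  have conj: "inv w \<otimes> t \<otimes> w = s i"
    using conj_eq_iff[of w t "s i"] wi t by simp
  have rev: "rev us \<in> lists I" using us by auto
  have "even (crossings (us @ rev us) t) = even (crossings [] t)"
    using us t rev wi by (intro crossings_parity) (auto simp: wprod_rev)
  then have "even (crossings us t + crossings (rev us) (s i))"
    using us t conj by (simp add: crossings_append)
  moreover have "crossings ?ts t = crossings us t + (1 + crossings (rev us) (s i))"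
    using us t conj wi(2) by (simp add: crossings_append m_assoc)
  ultimately have "odd (crossings ?ts t)" by simp
  moreover have "?ts \<in> lists I" using us rev wi by auto
  moreover have "wprod ?ts = t" using us rev wi by (simp add: wprod_rev m_assoc)
  ultimately show ?thesis using that by blast
qed

lemma odd_crossings_len_less:
  assumes "xs \<in> lists I" "t \<in> carrier W" "odd (crossings xs t)"
  shows "len (t \<otimes> wprod xs) < len (wprod xs)"
proof -
  obtain ys where ys: "ys \<in> lists I" "wprod ys = wprod xs" "length ys = len (wprod xs)"
    using reduced_word_exists[of "wprod xs"] assms(1) by (auto simp: reduced_word_def)
  have "odd (crossings ys t)"
    using crossings_parity[OF ys(1) assms(1) ys(2) assms(2)] assms(3) by simp
  then obtain as x bs where "ys = as @ x # bs" "t \<otimes> wprod ys = wprod (as @ bs)"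
    using crossing_deletes_letter[OF ys(1) assms(2)] by (metis even_zero)
  then show ?thesis using len_le[of "as @ bs"] ys by auto
qed

text \<open>
  Prefixing a word for \<open>t\<close> adds an odd number of crossings, and conjugating \<open>t\<close> by itself does
  nothing, so \<open>t w\<close> is on the odd side of the wall when \<open>w\<close> is on the even side; then \<open>t\<close> shortens
  \<open>t w\<close> to \<open>w\<close>.
\<close>

lemma even_crossings_len_greater:
  assumes "xs \<in> lists I" "t \<in> reflections" "even (crossings xs t)"
  shows "len (wprod xs) < len (t \<otimes> wprod xs)"
proof -
  obtain ts where ts: "ts \<in> lists I" "wprod ts = t" "odd (crossings ts t)"
    using reflection_self_crossing[OF assms(2)] .
  have t: "t \<in> carrier W" using assms by simp
  have "inv t \<otimes> t \<otimes> t = t" using t by simp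
  then have "odd (crossings (ts @ xs) t)"
    using ts assms(3) t by (simp add: crossings_append)
  then have "len (t \<otimes> wprod (ts @ xs)) < len (wprod (ts @ xs))"
    using ts assms(1) t by (intro odd_crossings_len_less) auto
  then show ?thesis
    using ts assms t by (simp add: reflection_cancel)
qed

lemma len_reflection_neq:
  assumes "w \<in> carrier W" "t \<in> reflections"
  shows "len (t \<otimes> w) \<noteq> len w"
proof -
  obtain xs where "xs \<in> lists I" "wprod xs = w" using ex_word[OF assms(1)] by auto
  then show ?thesis
    using odd_crossings_len_less[of xs t] even_crossings_len_greater[of xs t] assms(2) by force
qed

text \<open>
  The word may be non-reduced. This matters in \<open>chain_le_subword\<close>, where the letters deleted along a
  chain leave words that need not be reduced.
\<close>

lemma strong_exchange:
  assumes "xs \<in> lists I" "t \<in> reflections" "len (t \<otimes> wprod xs) < len (wprod xs)"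
  shows "\<exists>as x bs. xs = as @ x # bs \<and> t \<otimes> wprod xs = wprod (as @ bs)"
proof -
  have "odd (crossings xs t)"
    using even_crossings_len_greater[OF assms(1,2)] assms(3) by linarith
  then show ?thesis using crossing_deletes_letter[OF assms(1)] assms(2)
    by (metis even_zero reflection_closed)
qed

lemma len_mult_right_neq:
  assumes "w \<in> carrier W" "i \<in> I"
  shows "len (w \<otimes> s i) \<noteq> len w"
proof -
  \<comment> \<open>Right multiplication by a simple reflection is left multiplication by a conjugate.\<close>
  have "(w \<otimes> s i \<otimes> inv w) \<otimes> w = w \<otimes> s i"
    using assms by (simp add: m_assoc)
  then show ?thesis
    using len_reflection_neq[OF assms(1) conj_reflection[OF assms]] by simp
qed

text \<open>
  Prefixing a letter to a reduced word either keeps it reduced or, by the exchange property,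
  cancels against one of its letters; the latter yields a reduced word because length changes by
  at most one.
\<close>

lemma reduced_subword:
  assumes "xs \<in> lists I"
  shows "\<exists>zs. subseq zs xs \<and> reduced_word W I s (wprod xs) zs"
  using assms
proof (induction xs rule: list.induct)
  case Nil
  then show ?case using len_le[of "[]"] by (auto simp: reduced_word_def)
next
  case (Cons x xs)
  then obtain zs where sub: "subseq zs xs" and zs: "zs \<in> lists I" "wprod zs = wprod xs"
    "length zs = len (wprod xs)"
    by (auto simp: reduced_word_def)
  have x: "x \<in> I" and w: "wprod xs \<in> carrier W" using Cons.prems by auto
  show ?case
  proof (cases "len (s x \<otimes> wprod xs) < len (wprod xs)")
    case True
    then obtain as y bs where del: "zs = as @ y # bs" "s x \<otimes> wprod zs = wprod (as @ bs)"
      using strong_exchange[OF zs(1) s_reflection[OF x]] zs by auto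
    have "len (wprod xs) \<le> Suc (len (s x \<otimes> wprod xs))"
      using len_mult_left_le[of "s x \<otimes> wprod xs" x] x w by simp
    then have "length (as @ bs) = len (s x \<otimes> wprod xs)"
      using True zs(3) del(1) by simp
    moreover have "subseq (as @ bs) (x # xs)"
      using subseq_delete[of as bs y] del(1) sub by (meson subseq_Cons' subseq_order.trans subseq_order.refl list_emb_Cons)
    ultimately show ?thesis
      using del zs by (intro exI[of _ "as @ bs"]) (auto simp: reduced_word_def)
  next
    case False
    then have "len (s x \<otimes> wprod xs) = Suc (len (wprod xs))"
      using len_reflection_neq[OF w s_reflection[OF x]] len_mult_left_le[OF w x] by linarith
    then show ?thesis
      using sub zs x by (intro exI[of _ "x # zs"]) (auto simp: reduced_word_def)
  qed
qed

section \<open>Bruhat order by reflections\<close>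

definition bruhat_step :: "'a \<Rightarrow> 'a \<Rightarrow> bool" where
  "bruhat_step u v \<longleftrightarrow> u \<in> carrier W \<and> (\<exists>t\<in>reflections. v = t \<otimes> u) \<and> len u < len v"

abbreviation chain_le :: "'a \<Rightarrow> 'a \<Rightarrow> bool" where
  "chain_le \<equiv> bruhat_step\<^sup>*\<^sup>*"

lemma bruhat_step_mult_right:
  assumes "w \<in> carrier W" "i \<in> I" "len w < len (w \<otimes> s i)"
  shows "bruhat_step w (w \<otimes> s i)"
proof -
  have "w \<otimes> s i = (w \<otimes> s i \<otimes> inv w) \<otimes> w"
    using assms by (simp add: m_assoc)
  then show ?thesis
    unfolding bruhat_step_def using assms conj_reflection by blast
qed

lemma bruhat_step_pass_right:
  assumes "bruhat_step u v" "i \<in> I" "len (u \<otimes> s i) < len (v \<otimes> s i)"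
  shows "bruhat_step (u \<otimes> s i) (v \<otimes> s i)"
  using assms unfolding bruhat_step_def by (auto simp: m_assoc)

text \<open>
  If \<open>t\<close> shortened \<open>u s\<^sub>i\<close>, the exchange property would delete a letter from a reduced word of \<open>u s\<^sub>i\<close>
  that ends in \<open>i\<close>. Deleting the final letter forces \<open>v = u s\<^sub>i\<close>, and deleting any other one gives a
  word for \<open>v\<close> shorter than \<open>u\<close>.
\<close>

lemma len_pass_right:
  assumes "bruhat_step u v" "i \<in> I" "len u < len (u \<otimes> s i)" "v \<noteq> u \<otimes> s i"
  shows "len (u \<otimes> s i) < len (v \<otimes> s i)"
proof (rule ccontr)
  assume neg: "\<not> ?thesis"
  from assms(1) obtain t where t: "t \<in> reflections" "v = t \<otimes> u"
    and u: "u \<in> carrier W" and uv: "len u < len v"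
    by (auto simp: bruhat_step_def)
  have vs: "v \<otimes> s i = t \<otimes> (u \<otimes> s i)" using t u assms(2) by (simp add: m_assoc)
  obtain xs where xs: "xs \<in> lists I" "wprod xs = u" "length xs = len u"
    using reduced_word_exists[OF u] by (auto simp: reduced_word_def)
  have us: "wprod (xs @ [i]) = u \<otimes> s i" using xs assms(2) by simp
  have "len (v \<otimes> s i) < len (u \<otimes> s i)"
    using neg len_reflection_neq[of "u \<otimes> s i" t] t u assms(2) vs by simp
  then obtain as x bs where del: "xs @ [i] = as @ x # bs" "v \<otimes> s i = wprod (as @ bs)"
    using strong_exchange[of "xs @ [i]" t] xs(1) us vs t assms(2) by auto
  show False
  proof (cases bs rule: rev_cases)
    case Nil
    then have "v \<otimes> s i = u" using del xs by simp
    then have "v = u \<otimes> s i" using t u assms(2) by (metis m_closed reflection_closed s_cancel_right)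
    then show False using assms(4) by simp
  next
    case (snoc cs y)
    then have xs': "xs = as @ x # cs" "y = i" using del by simp_all
    have cs: "as @ cs \<in> lists I" using xs' xs by auto
    have "v \<otimes> s i = wprod (as @ cs) \<otimes> s i"
      using del(2) snoc xs' cs assms(2) by (simp add: m_assoc)
    then have "v = wprod (as @ cs)"
      using t u cs assms(2) by (metis m_closed reflection_closed s_cancel_right wprod_closed)
    then have "len v < len u" using len_le[OF cs] xs' xs(3) by simp
    then show False using uv by simp
  qed
qed

lemma bruhat_step_closed: "bruhat_step u v \<Longrightarrow> u \<in> carrier W \<and> v \<in> carrier W"
  by (auto simp: bruhat_step_def)

abbreviation up :: "'i \<Rightarrow> 'a \<Rightarrow> 'a" where "up \<equiv> hecke_pi W I s"
abbreviation down :: "'i \<Rightarrow> 'a \<Rightarrow> 'a" where "down \<equiv> hecke_pibar W I s"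

lemma up_eq:
  "w \<in> carrier W \<Longrightarrow> i \<in> I \<Longrightarrow> up i w = (if len (w \<otimes> s i) < len w then w else w \<otimes> s i)"
  by (simp add: hecke_pi_def right_descents_def)

lemma down_eq:
  "w \<in> carrier W \<Longrightarrow> i \<in> I \<Longrightarrow> down i w = (if len (w \<otimes> s i) < len w then w \<otimes> s i else w)"
  by (simp add: hecke_pibar_def right_descents_def)

text \<open>
  If \<open>s\<^sub>i\<close> acts on the lengths of \<open>u\<close> and \<open>v\<close> in the same direction, the step survives right
  multiplication by \<open>s\<^sub>i\<close> for reasons of length. If \<open>s\<^sub>i\<close> shortens \<open>u\<close> and lengthens \<open>v\<close>, the four
  elements form the chain \<open>u s\<^sub>i \<rightarrow> u \<rightarrow> v \<rightarrow> v s\<^sub>i\<close>. The opposite case is the content of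
  \<open>len_pass_right\<close>.
\<close>

lemma bruhat_step_up_down:
  assumes step: "bruhat_step u v" and i: "i \<in> I"
  shows "chain_le (up i u) (up i v) \<and> chain_le (down i u) (down i v)"
proof -
  have u: "u \<in> carrier W" and v: "v \<in> carrier W" using bruhat_step_closed[OF step] by auto
  have uv: "len u < len v" using step by (simp add: bruhat_step_def)
  have grow: "chain_le w (w \<otimes> s i)" if "w \<in> carrier W" "\<not> len (w \<otimes> s i) < len w" for w
    using that bruhat_step_mult_right[OF that(1) i] len_mult_right_neq[OF that(1) i]
    by (metis linorder_neqE_nat r_into_rtranclp)
  have shrink: "chain_le (w \<otimes> s i) w" if "w \<in> carrier W" "len (w \<otimes> s i) < len w" for w
    using that bruhat_step_mult_right[of "w \<otimes> s i" i] i by auto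
  consider
      (both) "len (u \<otimes> s i) < len u \<longleftrightarrow> len (v \<otimes> s i) < len v"
    | (u_only) "len (u \<otimes> s i) < len u" "\<not> len (v \<otimes> s i) < len v"
    | (v_only) "\<not> len (u \<otimes> s i) < len u" "len (v \<otimes> s i) < len v"
    by blast
  then show ?thesis
  proof cases
    case both
    \<comment> \<open>Both lengths change by exactly one and in the same direction.\<close>
    have "len u \<le> Suc (len (u \<otimes> s i))" "len v \<le> Suc (len (v \<otimes> s i))"
      using len_mult_right_le[of "u \<otimes> s i" i] len_mult_right_le[of "v \<otimes> s i" i] u v i by simp_all
    then have "len (u \<otimes> s i) < len (v \<otimes> s i)"
      using both uv len_mult_right_neq[OF u i] len_mult_right_neq[OF v i]
        len_mult_right_le[OF u i] by linarith
    then show ?thesis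
      using both bruhat_step_pass_right[OF step i] step u v i by (auto simp: up_eq down_eq)
  next
    case u_only
    have "chain_le u v" using step by blast
    then show ?thesis
      using u_only grow[OF v] shrink[OF u] u v i
      by (auto simp: up_eq down_eq intro: rtranclp_trans)
  next
    case v_only
    show ?thesis
    proof (cases "v = u \<otimes> s i")
      case True
      then show ?thesis using v_only u v i by (auto simp: up_eq down_eq)
    next
      case False
      have "len u < len (u \<otimes> s i)"
        using v_only len_mult_right_neq[OF u i] by linarith
      from bruhat_step_pass_right[OF step i len_pass_right[OF step i this False]]
      have "chain_le (u \<otimes> s i) (v \<otimes> s i)" by blast
      then show ?thesis
        using v_only grow[OF u] shrink[OF v] u v i
        by (auto simp: up_eq down_eq intro: rtranclp_trans)
    qed
  qed
qed

lemma chain_le_up_down: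
  assumes "chain_le u v" "i \<in> I"
  shows "chain_le (up i u) (up i v)" "chain_le (down i u) (down i v)"
  using assms(1) by (induction rule: rtranclp_induct)
    (auto dest: bruhat_step_up_down[OF _ assms(2)] intro: rtranclp_trans)

section \<open>The subword property\<close>

lemma reduced_snocD:
  assumes "xs @ [i] \<in> lists I" "len (wprod (xs @ [i])) = length (xs @ [i])"
  shows "len (wprod xs) = length xs" "up i (wprod xs) = wprod (xs @ [i])"
proof -
  have *: "xs \<in> lists I" "i \<in> I" "wprod xs \<in> carrier W" using assms by auto
  then show "len (wprod xs) = length xs"
    using assms(2) len_mult_right_le[of "wprod xs" i] len_le[of xs] by simp
  then show "up i (wprod xs) = wprod (xs @ [i])"
    using * assms(2) by (simp add: up_eq)
qed

text \<open>
  Induction from the right end. If the last letter \<open>i\<close> of \<open>ys\<close> is left out of \<open>xs\<close>, removing it from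
  \<open>ys\<close> is a step down. If it is used, both words are reduced, so the products with and without the
  last letter are related by \<open>up i\<close>, which preserves the chain order.
\<close>

lemma subword_chain_le:
  assumes "ys \<in> lists I" "len (wprod ys) = length ys"
    "subseq xs ys" "len (wprod xs) = length xs"
  shows "chain_le (wprod xs) (wprod ys)"
  using assms
proof (induction ys arbitrary: xs rule: rev_induct)
  case (snoc i ys)
  have i: "i \<in> I" and ys: "ys \<in> lists I" using snoc.prems by auto
  note red = reduced_snocD[OF snoc.prems(1,2)]
  consider (drop) "subseq xs ys" | (keep) xs' where "xs = xs' @ [i]" "subseq xs' ys"
  proof -
    obtain xs1 xs2 where xs: "xs = xs1 @ xs2" "subseq xs1 ys" "subseq xs2 [i]"
      using snoc.prems(3) by (auto simp: subseq_append_iff)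
    then have "xs2 = [] \<or> xs2 = [i]"
      by (cases xs2) (auto split: if_splits)
    then show thesis using xs that by auto
  qed
  then show ?case
  proof cases
    case drop
    have "bruhat_step (wprod ys) (wprod ys \<otimes> s i)"
      using snoc.prems(2) red(1) ys i by (intro bruhat_step_mult_right) simp_all
    then show ?thesis
      using snoc.IH[OF ys red(1) drop snoc.prems(4)] ys i by (simp add: rtranclp.rtrancl_into_rtrancl)
  next
    case keep
    have xs: "xs' @ [i] \<in> lists I"
      using keep ys i by (auto elim: list_emb_set)
    note red' = reduced_snocD[OF xs snoc.prems(4)[unfolded keep(1)]]
    show ?thesis
      using chain_le_up_down(1)[OF snoc.IH[OF ys red(1) keep(2) red'(1)] i]
      by (simp only: red(2) red'(2) keep(1))
  qed
qed (auto dest: list_emb_Nil2)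

lemma chain_le_subword:
  assumes "chain_le u v" "ys \<in> lists I" "wprod ys = v"
  shows "\<exists>xs. subseq xs ys \<and> xs \<in> lists I \<and> wprod xs = u"
  using assms(1)
proof (induction rule: converse_rtranclp_induct)
  case base
  then show ?case using assms(2,3) by blast
next
  case (step u u')
  then obtain xs where xs: "subseq xs ys" "xs \<in> lists I" "wprod xs = u'" by blast
  from step(1) obtain t where t: "t \<in> reflections" "u' = t \<otimes> u" "u \<in> carrier W" "len u < len u'"
    by (auto simp: bruhat_step_def)
  then have u: "u = t \<otimes> wprod xs" using xs by (simp add: reflection_cancel)
  then obtain as x bs where "xs = as @ x # bs" "u = wprod (as @ bs)"
    using strong_exchange[OF xs(2) t(1)] t xs by auto
  then show ?case
    using xs subseq_delete[of as bs x] by (intro exI[of _ "as @ bs"]) (auto intro: subseq_order.trans)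
qed

text \<open>
  In the direction from chains the word \<open>ys\<close> can be any reduced word of \<open>v\<close>. Thus the existential
  choice of the word for \<open>v\<close> in the definition of Bruhat order is immaterial, and transitivity
  comes for free.
\<close>

lemma bruhat_le_iff_chain_le:
  assumes "v \<in> carrier W"
  shows "le u v \<longleftrightarrow> chain_le u v"
proof
  assume "le u v"
  then show "chain_le u v"
    using subword_chain_le unfolding bruhat_le_def reduced_word_def by metis
next
  assume "chain_le u v"
  obtain ys where ys: "reduced_word W I s v ys" using reduced_word_exists[OF assms] by blast
  then obtain xs where xs: "subseq xs ys" "xs \<in> lists I" "wprod xs = u"
    using chain_le_subword[OF \<open>chain_le u v\<close>] by (auto simp: reduced_word_def)
  from reduced_subword[OF xs(2)] show "le u v"
    using xs ys unfolding bruhat_le_def by (metis subseq_order.trans)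
qed

section \<open>The biHecke monoid\<close>

text \<open>
  Closure of \<open>W\<close> under \<open>f\<close> is proved together with monotonicity because products in the monoid are
  compositions restricted to \<open>carrier W\<close>.
\<close>

lemma biHecke_closed_mono:
  assumes "f \<in> carrier (biHecke_monoid W I s)"
  shows "(\<forall>u\<in>carrier W. f u \<in> carrier W)
    \<and> (\<forall>u\<in>carrier W. \<forall>v\<in>carrier W. chain_le u v \<longrightarrow> chain_le (f u) (f v))"
proof -
  have "f \<in> submonoid_gen (transformation_monoid (carrier W)) (up ` I \<union> down ` I)"
    using assms by (simp add: biHecke_monoid_def)
  then show ?thesis
  proof induction
    case one
    then show ?case by (simp add: transformation_monoid_def)
  next
    case (incl f)
    then obtain i where i: "i \<in> I" "f = up i \<or> f = down i" by auto
    have "f u \<in> carrier W" if "u \<in> carrier W" for u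
      using i that by (auto simp: up_eq down_eq)
    then show ?case using i chain_le_up_down by blast
  next
    case (mult f g)
    then show ?case by (simp add: transformation_monoid_def compose_def)
  qed
qed

end

theorem proposition3p3:
  fixes W :: "('a, 'b) monoid_scheme"
    and I :: "'i set"
    and s :: "'i \<Rightarrow> 'a"
    and m :: "'i \<Rightarrow> 'i \<Rightarrow> nat"
    and f :: "'a \<Rightarrow> 'a"
  assumes "coxeter_group W I s m"
    and "finite (carrier W)"
    and "f \<in> carrier (biHecke_monoid W I s)"
  shows "\<forall>u \<in> carrier W. \<forall>v \<in> carrier W.
    bruhat_le W I s u v \<longrightarrow> bruhat_le W I s (f u) (f v)"
proof -
  interpret group W using assms(1) by (simp add: coxeter_group_def)
  interpret coxeter W I s m by unfold_locales (rule assms(1))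
  show ?thesis
    using biHecke_closed_mono[OF assms(3)] by (simp add: bruhat_le_iff_chain_le)
qed

end
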